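(* Let $(f_k)_{k\ge 0}$ be a sequence of complex numbers with $\ln k=o(\ln|f_k|)$ as $k\to+\infty$. Let $(\lambda_k(\omega))_{k\ge 0}$ be a sequence of pairwise independent positive random variables on a probability space $(\Omega,\mathcal A,P)$, with distribution functions $F_k(x):=P\{\omega:\lambda_k(\omega)<x\}$, $x\in\mathbb R$, $k\ge 0$. Let $\sigma(f,\omega)$ be the abscissa of absolute convergence of the Dirichlet series $f(z,\omega)=\sum_{k=0}^{+\infty}f_k e^{z\lambda_k(\omega)}$. Then: (i) If $\rho\in(0,+\infty)$ and $\sigma(f,\omega)\ge\rho$ almost surely, then for every $\varepsilon\in(0,\rho)$ $$\sum_{k=0}^{+\infty}\Big(1-F_k\Big(\frac{\ln|f_k|}{-\rho+\varepsilon}\Big)\Big)<+\infty.$$ (ii) If $\rho\in(-\infty,0]$ and $0\ge\sigma(f,\omega)\ge\rho$ almost surely, then for every $\varepsilon>0$ $$\sum_{k=0}^{+\infty}F_k\Big(\frac{\ln|f_k|}{-\rho+\varepsilon}\Big)<+\infty.$$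
   Context: For fixed $\omega$, the abscissa of absolute convergence is $\sigma(f,\omega)=\sigma_a(f,\omega):=\sup\{\operatorname{Re} z: z\in\mathbb C,\ \sum_k |f_k e^{z\lambda_k(\omega)}|<+\infty\}\in[-\infty,+\infty]$ (with $\sup\emptyset=-\infty$). Conventions: $\ln 0=-\infty$, $F_k(-\infty)=0$, $F_k(+\infty)=1$. The condition $\ln k=o(\ln|f_k|)$ means $\ln k/\ln|f_k|\to 0$ as $k\to+\infty$. *)

theory Defs
  imports "HOL-Probability.Probability"
begin

text \<open>The logarithm on the nonnegative reals with the convention \<open>ln 0 = -\<infinity>\<close>
  (the library's real-valued \<open>ln\<close> has \<open>ln 0 = 0\<close>).\<close>

definition eln :: "real \<Rightarrow> ereal" where
  "eln x = (if x = 0 then -\<infinity> else ereal (ln x))"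

text \<open>The supremum is taken in the extended reals, so it is \<open>-\<infinity>\<close> for the empty set.\<close>

definition abscissa :: "(nat \<Rightarrow> complex) \<Rightarrow> (nat \<Rightarrow> real) \<Rightarrow> ereal" where
  "abscissa f l =
     Sup {ereal (Re z) | z. summable (\<lambda>k. norm (f k * exp (z * complex_of_real (l k))))}"

text \<open>Left-continuous distribution function (strict inequality, unlike the library's \<open>cdf\<close>),
  with extended real argument.\<close>

definition dist_fun :: "'a measure \<Rightarrow> ('a \<Rightarrow> real) \<Rightarrow> ereal \<Rightarrow> real" where
  "dist_fun M X x = measure M {\<omega> \<in> space M. ereal (X \<omega>) < x}"

lemma dist_fun_real: "dist_fun M X (ereal x) = measure M {\<omega> \<in> space M. X \<omega> < x}"
  by (simp add: dist_fun_def)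

lemma dist_fun_minf: "dist_fun M X (-\<infinity>) = 0"
  by (simp add: dist_fun_def)

lemma (in prob_space) dist_fun_pinf: "dist_fun M X \<infinity> = 1"
  by (simp add: dist_fun_def prob_space)

text \<open>\<open>ln k = o(ln |f k|)\<close> as convergence of the quotient in the extended reals. There
  \<open>x / (-\<infinity>) = 0\<close>, so indices with \<open>f k = 0\<close> are harmless, while \<open>x / 0 = \<infinity>\<close> for \<open>x > 0\<close>, so
  \<open>|f k| = 1\<close> is excluded for large \<open>k\<close> (real division by zero would admit it).\<close>

definition ln_index_small :: "(nat \<Rightarrow> complex) \<Rightarrow> bool" where
  "ln_index_small f \<longleftrightarrow> (\<lambda>k. eln (real k) / eln (norm (f k))) \<longlonglongrightarrow> 0"

lemma eln_ratio_zero_coeff: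
  assumes "k \<ge> 1" "f k = 0"
  shows "eln (real k) / eln (norm (f k)) = 0"
  using assms by (simp add: eln_def)

lemma eln_ratio_unit_coeff:
  assumes "k \<ge> 2" "norm (f k) = 1"
  shows "eln (real k) / eln (norm (f k)) = \<infinity>"
  using assms by (simp add: eln_def divide_ereal_def)

end

theory Submission
  imports Defs
begin

text \<open>
  Put \<open>a = \<rho> - \<epsilon>\<close> and call index \<open>k\<close> large at \<open>\<omega>\<close> when \<open>|f\<^sub>k| e\<^bsup>a\<lambda>\<^sub>k(\<omega>)\<^esup> \<ge> 1\<close>. If the abscissa
  at \<open>\<omega>\<close> is at least \<open>\<rho> > a\<close>, the series converges absolutely at \<open>a\<close> (the exponents are
  positive), so its terms tend to zero and only finitely many indices are large. Hence almost
  surely only finitely many of the events ``\<open>k\<close> is large'' occur. These events are pairwise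
  independent, and for such events the second Borel--Cantelli lemma still holds, so their
  probabilities are summable (\<open>summable_prob_large_terms\<close>).

  Both claims are this one statement after taking logarithms: \<open>k\<close> is large iff
  \<open>ln |f\<^sub>k| \<ge> -a \<lambda>\<^sub>k\<close>. For \<open>a > 0\<close>, dividing by \<open>-a < 0\<close> shows that largeness is the complement
  of the event measured by \<open>F\<^sub>k\<close>; for \<open>a < 0\<close>, dividing by \<open>-a > 0\<close> shows that
  the event measured by \<open>F\<^sub>k\<close> is contained in largeness.
\<close>

text \<open>Pairwise independence makes the indicators uncorrelated, so the variance of the number of
  events that occur is the sum of the individual variances \<open>p\<^sub>k - p\<^sub>k\<^sup>2\<close>.\<close>

lemma (in prob_space) variance_count_pairwise_indep_le:
  fixes A :: "'i \<Rightarrow> 'a set"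
  assumes "finite I"
    and A: "\<And>k. A k \<in> events"
    and indep: "\<And>j k. j \<noteq> k \<Longrightarrow> prob (A j \<inter> A k) = prob (A j) * prob (A k)"
  shows "expectation (\<lambda>\<omega>. (\<Sum>k\<in>I. indicator (A k) \<omega> - prob (A k))\<^sup>2) \<le> (\<Sum>k\<in>I. prob (A k))"
proof -
  have integrable: "integrable M (\<lambda>\<omega>. indicator B \<omega> :: real)" if "B \<in> events" for B
    using that by (simp add: emeasure_eq_measure)
  let ?g = "\<lambda>j k \<omega>. indicator (A j \<inter> A k) \<omega> - prob (A k) * indicator (A j) \<omega>
                  - prob (A j) * indicator (A k) \<omega> + prob (A j) * prob (A k)"
  have g: "integrable M (?g j k)" "expectation (?g j k) = prob (A j \<inter> A k) - prob (A j) * prob (A k)"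
    for j k
    using A integrable by (simp_all add: prob_space sets.Int)
  have "(\<Sum>k\<in>I. indicator (A k) \<omega> - prob (A k))\<^sup>2 = (\<Sum>j\<in>I. \<Sum>k\<in>I. ?g j k \<omega>)" for \<omega>
    unfolding power2_eq_square sum_product
    by (intro sum.cong refl) (simp add: indicator_inter_arith algebra_simps)
  then have "expectation (\<lambda>\<omega>. (\<Sum>k\<in>I. indicator (A k) \<omega> - prob (A k))\<^sup>2)
      = (\<Sum>j\<in>I. \<Sum>k\<in>I. prob (A j \<inter> A k) - prob (A j) * prob (A k))"
    using g by simp
  also have "\<dots> = (\<Sum>j\<in>I. \<Sum>k\<in>I. if k = j then prob (A j) - (prob (A j))\<^sup>2 else 0)"
    by (intro sum.cong refl) (auto simp: indep power2_eq_square)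
  also have "\<dots> = (\<Sum>j\<in>I. prob (A j) - (prob (A j))\<^sup>2)"
    using \<open>finite I\<close> by simp
  also have "\<dots> \<le> (\<Sum>k\<in>I. prob (A k))"
    by (intro sum_mono) simp
  finally show ?thesis .
qed

text \<open>The second Borel--Cantelli lemma for pairwise independent events, in contrapositive form.
  For some \<open>m\<close>, with probability at least \<open>1/2\<close> no event of index \<open>\<ge> m\<close> occurs. There the
  count of events in a block \<open>{m..<n}\<close> is zero, which is a deviation by its full mean \<open>S\<close>; so the
  variance, at most \<open>S\<close>, is at least \<open>S\<^sup>2 / 2\<close>. Hence \<open>S \<le> 2\<close> for every \<open>n\<close>.\<close>

lemma (in prob_space) summable_prob_if_AE_finitely_many:
  fixes A :: "nat \<Rightarrow> 'a set"
  assumes A: "\<And>k. A k \<in> events"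
    and indep: "\<And>j k. j \<noteq> k \<Longrightarrow> prob (A j \<inter> A k) = prob (A j) * prob (A k)"
    and fin: "AE \<omega> in M. eventually (\<lambda>k. \<omega> \<notin> A k) sequentially"
  shows "summable (\<lambda>k. prob (A k))"
proof -
  define D where "D m = {\<omega> \<in> space M. \<forall>k\<ge>m. \<omega> \<notin> A k}" for m
  have D: "D m \<in> events" for m
    unfolding D_def using A by measurable
  have "incseq D"
    by (auto simp: incseq_def D_def)
  then have "(\<lambda>m. prob (D m)) \<longlonglongrightarrow> prob (\<Union>m. D m)"
    using D by (intro finite_Lim_measure_incseq) auto
  moreover have "prob (\<Union>m. D m) = 1"
  proof (rule prob_eq_1[THEN iffD2])
    show "(\<Union>m. D m) \<in> events" using D by auto
    show "AE \<omega> in M. \<omega> \<in> (\<Union>m. D m)"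
      using fin AE_space by eventually_elim (auto simp: D_def eventually_sequentially)
  qed
  ultimately have "eventually (\<lambda>m. prob (D m) > 1/2) sequentially"
    by (intro order_tendstoD(1)) auto
  then obtain m where m: "prob (D m) > 1/2"
    by (auto simp: eventually_sequentially)
  have bound: "(\<Sum>k=m..<n. prob (A k)) \<le> 2" for n
  proof -
    define S where "S = (\<Sum>k=m..<n. prob (A k))"
    let ?V = "\<lambda>\<omega>. (\<Sum>k=m..<n. indicator (A k) \<omega> - prob (A k))\<^sup>2"
    have S0: "S \<ge> 0" unfolding S_def by (simp add: sum_nonneg)
    have "integrable M ?V"
    proof (rule integrable_const_bound)
      show "AE \<omega> in M. norm (?V \<omega>) \<le> (real (card {m..<n}))\<^sup>2"
      proof (rule AE_I2)
        fix \<omega>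
        have "\<bar>indicator (A k) \<omega> - prob (A k)\<bar> \<le> 1" for k
          by (simp add: indicator_def)
        then have "\<bar>\<Sum>k=m..<n. indicator (A k) \<omega> - prob (A k)\<bar> \<le> (\<Sum>k=m..<n. 1)"
          by (intro order_trans[OF sum_abs] sum_mono)
        then have "\<bar>\<Sum>k=m..<n. indicator (A k) \<omega> - prob (A k)\<bar> \<le> real (card {m..<n})" by simp
        then have "\<bar>\<Sum>k=m..<n. indicator (A k) \<omega> - prob (A k)\<bar>\<^sup>2 \<le> (real (card {m..<n}))\<^sup>2"
          by (intro power_mono) auto
        then show "norm (?V \<omega>) \<le> (real (card {m..<n}))\<^sup>2" by simp
      qed
      show "?V \<in> borel_measurable M" using A by measurable
    qed
    moreover have "integrable M (\<lambda>\<omega>. S\<^sup>2 * indicator (D m) \<omega>)"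
      using D by (simp add: emeasure_eq_measure)
    moreover have "S\<^sup>2 * indicator (D m) \<omega> \<le> ?V \<omega>" for \<omega>
    proof (cases "\<omega> \<in> D m")
      case True
      then have "(\<Sum>k=m..<n. indicator (A k) \<omega> - prob (A k)) = (\<Sum>k=m..<n. - prob (A k))"
        by (intro sum.cong) (auto simp: D_def)
      then show ?thesis using True by (simp add: S_def sum_negf)
    qed simp
    ultimately have "expectation (\<lambda>\<omega>. S\<^sup>2 * indicator (D m) \<omega>) \<le> expectation ?V"
      by (intro integral_mono) auto
    also have "\<dots> \<le> S"
      unfolding S_def by (rule variance_count_pairwise_indep_le) (use A indep in auto)
    finally have "S\<^sup>2 * prob (D m) \<le> S"
      using D by simp
    moreover have "S\<^sup>2 * (1/2) \<le> S\<^sup>2 * prob (D m)"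
      using m by (intro mult_left_mono) auto
    ultimately have "S * S \<le> 2 * S" by (simp add: power2_eq_square)
    then show ?thesis using S0 unfolding S_def[symmetric]
      by (cases "S = 0") (auto simp: mult_le_cancel_right)
  qed
  have "summable (\<lambda>k. prob (A (k + m)))"
  proof (rule summableI_nonneg_bounded)
    show "(\<Sum>k<n. prob (A (k + m))) \<le> 2" for n
      using bound[of "n + m"] sum.shift_bounds_nat_ivl[of "\<lambda>k. prob (A k)" 0 m n]
      by (simp add: atLeast0LessThan)
  qed simp
  then show ?thesis by (rule summable_iff_shift[THEN iffD1])
qed

text \<open>Because the exponents are nonnegative, the terms at \<open>a\<close> are dominated by those at any point
  with larger real part; some such point is a point of absolute convergence, and there the terms
  tend to zero.\<close>

lemma eventually_term_lt_1_left_of_abscissa: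
  assumes pos: "\<And>k. l k \<ge> 0" and a: "ereal a < abscissa f l"
  shows "eventually (\<lambda>k. norm (f k) * exp (a * l k) < 1) sequentially"
proof -
  obtain z where z: "summable (\<lambda>k. norm (f k * exp (z * complex_of_real (l k))))" "a < Re z"
    using a unfolding abscissa_def less_Sup_iff by auto
  have "eventually (\<lambda>k. norm (f k * exp (z * complex_of_real (l k))) < 1) sequentially"
    by (rule order_tendstoD(2)[OF summable_LIMSEQ_zero[OF z(1)]]) simp
  then show ?thesis
  proof eventually_elim
    case (elim k)
    have "norm (f k) * exp (a * l k) \<le> norm (f k) * exp (Re z * l k)"
      using z(2) pos[of k] by (intro mult_left_mono) (auto intro: mult_right_mono)
    then show ?case using elim by (simp add: norm_mult)
  qed
qed

text \<open>Each event is the preimage under \<open>L k\<close> of a Borel set of reals, so the events inherit pairwise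
  independence from the variables. The sign of \<open>a\<close> is left open, since the two claims use
  different signs.\<close>

lemma (in prob_space) summable_prob_large_terms:
  fixes f :: "nat \<Rightarrow> complex" and L :: "nat \<Rightarrow> 'a \<Rightarrow> real"
  assumes L: "\<And>k. random_variable borel (L k)"
    and pos: "\<And>k \<omega>. \<omega> \<in> space M \<Longrightarrow> L k \<omega> \<ge> 0"
    and indep: "\<And>j k. j \<noteq> k \<Longrightarrow> indep_var borel (L j) borel (L k)"
    and absc: "AE \<omega> in M. ereal a < abscissa f (\<lambda>k. L k \<omega>)"
  shows "summable (\<lambda>k. prob {\<omega> \<in> space M. 1 \<le> norm (f k) * exp (a * L k \<omega>)})"
proof (rule summable_prob_if_AE_finitely_many)
  let ?A = "\<lambda>k. {\<omega> \<in> space M. 1 \<le> norm (f k) * exp (a * L k \<omega>)}"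
  let ?B = "\<lambda>k. {x \<in> space borel. 1 \<le> norm (f k) * exp (a * x)}"
  show "?A k \<in> events" for k
    using L by measurable
  show "prob (?A j \<inter> ?A k) = prob (?A j) * prob (?A k)" if "j \<noteq> k" for j k
  proof -
    have B: "?B i \<in> sets borel" for i by measurable
    have "prob ((\<lambda>x. (L j x, L k x)) -` (?B j \<times> ?B k) \<inter> space M) =
        prob (L j -` ?B j \<inter> space M) * prob (L k -` ?B k \<inter> space M)"
      by (rule indep_varD[OF indep[OF that] B B])
    moreover have "(\<lambda>x. (L j x, L k x)) -` (?B j \<times> ?B k) \<inter> space M = ?A j \<inter> ?A k"
      "L i -` ?B i \<inter> space M = ?A i" for i
      by auto
    ultimately show ?thesis by simp
  qed
  show "AE \<omega> in M. eventually (\<lambda>k. \<omega> \<notin> ?A k) sequentially"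
    using absc AE_space
  proof eventually_elim
    case (elim \<omega>)
    have "eventually (\<lambda>k. norm (f k) * exp (a * L k \<omega>) < 1) sequentially"
      using elim pos by (intro eventually_term_lt_1_left_of_abscissa) auto
    then show ?case by eventually_elim auto
  qed
qed

lemma one_le_mult_exp_iff:
  assumes "(c::real) > 0"
  shows "1 \<le> c * exp t \<longleftrightarrow> - t \<le> ln c"
proof -
  have "c * exp t = exp (ln c + t)" using assms by (simp add: exp_add)
  then show ?thesis by auto
qed

theorem theorem3:
  fixes M :: "'a measure"
    and f :: "nat \<Rightarrow> complex"
    and L :: "nat \<Rightarrow> 'a \<Rightarrow> real"
  assumes "prob_space M"
    and "ln_index_small f"
    and "\<And>k. L k \<in> borel_measurable M"
    and "\<And>k \<omega>. \<omega> \<in> space M \<Longrightarrow> L k \<omega> > 0"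
    and "\<And>j k. j \<noteq> k \<Longrightarrow> prob_space.indep_var M borel (L j) borel (L k)"
  shows "(\<forall>\<rho>::real. 0 < \<rho> \<and> (AE \<omega> in M. abscissa f (\<lambda>k. L k \<omega>) \<ge> ereal \<rho>) \<longrightarrow>
            (\<forall>\<epsilon>::real. 0 < \<epsilon> \<and> \<epsilon> < \<rho> \<longrightarrow>
              summable (\<lambda>k. 1 - dist_fun M (L k) (eln (norm (f k)) / ereal (- \<rho> + \<epsilon>)))))
       \<and> (\<forall>\<rho>::real. \<rho> \<le> 0 \<and> (AE \<omega> in M. 0 \<ge> abscissa f (\<lambda>k. L k \<omega>) \<and>
                                         abscissa f (\<lambda>k. L k \<omega>) \<ge> ereal \<rho>) \<longrightarrow>
            (\<forall>\<epsilon>::real. 0 < \<epsilon> \<longrightarrow>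
              summable (\<lambda>k. dist_fun M (L k) (eln (norm (f k)) / ereal (- \<rho> + \<epsilon>)))))"
proof -
  interpret prob_space M by fact
  note L = assms(3)
  define A where "A a k = {\<omega> \<in> space M. 1 \<le> norm (f k) * exp (a * L k \<omega>)}" for a k
  have A: "A a k \<in> events" for a k
    unfolding A_def using L by measurable
  have summable_A: "summable (\<lambda>k. prob (A (\<rho> - \<epsilon>) k))"
    if "AE \<omega> in M. ereal \<rho> \<le> abscissa f (\<lambda>k. L k \<omega>)" "\<epsilon> > 0" for \<rho> \<epsilon>
    unfolding A_def
  proof (rule summable_prob_large_terms)
    show "AE \<omega> in M. ereal (\<rho> - \<epsilon>) < abscissa f (\<lambda>k. L k \<omega>)"
      using that(1) by eventually_elim (use that(2) in \<open>auto elim!: less_le_trans[rotated]\<close>)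
  qed (use assms in \<open>auto intro: less_imp_le\<close>)
  have compl_dist_fun_eq: "1 - dist_fun M (L k) (eln (norm (f k)) / ereal (- \<rho> + \<epsilon>)) = prob (A (\<rho> - \<epsilon>) k)"
    if "\<epsilon> < \<rho>" for \<rho> \<epsilon> k
  proof -
    let ?x = "eln (norm (f k)) / ereal (- \<rho> + \<epsilon>)"
    have "{\<omega> \<in> space M. ereal (L k \<omega>) < ?x} = space M - A (\<rho> - \<epsilon>) k"
    proof (cases "f k = 0")
      case True
      \<comment> \<open>By \<open>ln 0 = -\<infinity>\<close> the threshold is \<open>+\<infinity>\<close>, in accordance with a zero term never being large.\<close>
      then have "?x = \<infinity>"
        using that by (simp add: eln_def divide_ereal_def)
      then show ?thesis using True by (auto simp: A_def)
    next
      case False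
      then have x: "?x = ereal (ln (norm (f k)) / (- \<rho> + \<epsilon>))"
        using that by (simp add: eln_def)
      have "L k \<omega> < ln (norm (f k)) / (- \<rho> + \<epsilon>) \<longleftrightarrow>
          \<not> 1 \<le> norm (f k) * exp ((\<rho> - \<epsilon>) * L k \<omega>)" for \<omega>
        using False that by (subst one_le_mult_exp_iff) (auto simp: field_simps)
      then show ?thesis unfolding x A_def by auto
    qed
    then show ?thesis
      using prob_compl[OF A, of "\<rho> - \<epsilon>" k] by (simp add: dist_fun_def)
  qed
  have dist_fun_le: "dist_fun M (L k) (eln (norm (f k)) / ereal (- \<rho> + \<epsilon>)) \<le> prob (A (\<rho> - \<epsilon>) k)"
    if "\<rho> < \<epsilon>" for \<rho> \<epsilon> k
  proof -
    let ?x = "eln (norm (f k)) / ereal (- \<rho> + \<epsilon>)"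
    have "{\<omega> \<in> space M. ereal (L k \<omega>) < ?x} \<subseteq> A (\<rho> - \<epsilon>) k"
    proof (cases "f k = 0")
      case True
      \<comment> \<open>By \<open>ln 0 = -\<infinity>\<close> the threshold is \<open>-\<infinity>\<close>, in accordance with a zero term never being large.\<close>
      then have "?x = - \<infinity>"
        using that by (simp add: eln_def divide_ereal_def)
      then show ?thesis by auto
    next
      case False
      then have x: "?x = ereal (ln (norm (f k)) / (- \<rho> + \<epsilon>))"
        using that by (simp add: eln_def)
      have "1 \<le> norm (f k) * exp ((\<rho> - \<epsilon>) * L k \<omega>)"
        if "L k \<omega> < ln (norm (f k)) / (- \<rho> + \<epsilon>)" for \<omega>
        using False that \<open>\<rho> < \<epsilon>\<close> by (subst one_le_mult_exp_iff) (auto simp: field_simps)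
      then show ?thesis unfolding x A_def by auto
    qed
    then show ?thesis
      unfolding dist_fun_def using A by (intro finite_measure_mono) auto
  qed
  show ?thesis
  proof (intro conjI allI impI)
    fix \<rho> \<epsilon> :: real
    assume "0 < \<rho> \<and> (AE \<omega> in M. abscissa f (\<lambda>k. L k \<omega>) \<ge> ereal \<rho>)" "0 < \<epsilon> \<and> \<epsilon> < \<rho>"
    then show "summable (\<lambda>k. 1 - dist_fun M (L k) (eln (norm (f k)) / ereal (- \<rho> + \<epsilon>)))"
      using summable_A[of \<rho> \<epsilon>] by (simp only: compl_dist_fun_eq)
  next
    fix \<rho> \<epsilon> :: real
    assume \<rho>: "\<rho> \<le> 0 \<and> (AE \<omega> in M. 0 \<ge> abscissa f (\<lambda>k. L k \<omega>) \<and>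
                                         abscissa f (\<lambda>k. L k \<omega>) \<ge> ereal \<rho>)" and \<epsilon>: "0 < \<epsilon>"
    have "summable (\<lambda>k. prob (A (\<rho> - \<epsilon>) k))"
      using \<rho> \<epsilon> by (intro summable_A) auto
    then show "summable (\<lambda>k. dist_fun M (L k) (eln (norm (f k)) / ereal (- \<rho> + \<epsilon>)))"
    proof (rule summable_comparison_test'[where N = 0])
      fix k
      show "norm (dist_fun M (L k) (eln (norm (f k)) / ereal (- \<rho> + \<epsilon>))) \<le> prob (A (\<rho> - \<epsilon>) k)"
        using dist_fun_le[of \<rho> \<epsilon> k] \<rho> \<epsilon> by (simp add: dist_fun_def)
    qed
  qed
qed

end
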